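(* Let $(X,\alpha,\leq,\wedge,\vee)$ be a $\mathbb{Z}_2$-decreasing lattice. (1) If there exists a point $\theta\in X$ with $\alpha(\theta)=\theta$ such that, for every $a,b\in X$ with $a\leq b$, $$a\vee(\theta\wedge b)=(a\vee\theta)\wedge b,$$ then the map $p:X\times X\to X$ defined by $$p(x,y):=(x\wedge y)\vee\bigl(\theta\wedge(x\vee y)\bigr)$$ is an equivariant mean on $X$. (2) If, in addition (to the existence of such a $\theta$), $X$ is an AR (respectively, an AE), then $(X,\alpha)$ is a $\mathbb{Z}_2$-AR (respectively, a $\mathbb{Z}_2$-AE).
   Context: All spaces are Hausdorff. An involution on a space $X$ is a continuous map $\alpha:X\to X$ with $\alpha\circ\alpha=1_X$; it corresponds to an action of $\mathbb Z_2=\{-1,1\}$ with $-1\cdot x=\alpha(x)$, and $(X,\alpha)$ denotes this $\mathbb Z_2$-space. A subset $A$ is invariant if $\alpha(A)=A$; a function $f:(X,\alpha)\to(Y,\beta)$ is equivariant if $f\circ\alpha=\beta\circ f$. A topological lattice is a Hausdorff space $X$ with a lattice structure $(X,\leq,\wedge,\vee)$ such that $\wedge,\vee:X\times X\to X$ are continuous. A $\mathbb Z_2$-decreasing lattice $(X,\alpha,\leq,\wedge,\vee)$ is a topological lattice $(X,\leq,\wedge,\vee)$ with an involution $\alpha:X\to X$ such that $x\leq y$ implies $\alpha(y)\leq\alpha(x)$. A mean on $X$ is a continuous map $p:X\times X\to X$ with $p(x,x)=x$ and $p(x,y)=p(y,x)$ for all $x,y\in X$. It is equivariant if $p(\alpha(x),\alpha(y))=\alpha(p(x,y))$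 for all $x,y$. A $\mathbb Z_2$-space $Y$ is a $\mathbb Z_2$-AE if for every metrizable $\mathbb Z_2$-space $Z$, every closed invariant $A\subseteq Z$ and every continuous equivariant $f:A\to Y$ there is a continuous equivariant $F:Z\to Y$ with $F|_A=f$. A metrizable $\mathbb Z_2$-space $Y$ is a $\mathbb Z_2$-AR if for every metrizable $\mathbb Z_2$-space $Z$ containing $Y$ as a closed invariant subset there is a continuous equivariant retraction $Z\to Y$. AE and AR are the same notions without group action; in particular an AR is metrizable. *)

theory Defs
  imports "HOL-Analysis.Analysis" "HOL-Algebra.Lattice"
begin

text \<open>
  Spaces are abstract topologies, and maps on a space are constrained on its \<open>topspace\<close> only.
\<close>

definition involution_on_space :: "'a topology \<Rightarrow> ('a \<Rightarrow> 'a) \<Rightarrow> bool" where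
  "involution_on_space X \<alpha> \<longleftrightarrow>
     continuous_map X X \<alpha> \<and> (\<forall>x \<in> topspace X. \<alpha> (\<alpha> x) = x)"

definition Z2_space :: "'a topology \<Rightarrow> ('a \<Rightarrow> 'a) \<Rightarrow> bool" where
  "Z2_space X \<alpha> \<longleftrightarrow> Hausdorff_space X \<and> involution_on_space X \<alpha>"

definition equivariant_on :: "'a set \<Rightarrow> ('a \<Rightarrow> 'a) \<Rightarrow> ('b \<Rightarrow> 'b) \<Rightarrow> ('a \<Rightarrow> 'b) \<Rightarrow> bool" where
  "equivariant_on S \<alpha> \<beta> f \<longleftrightarrow> (\<forall>x \<in> S. f (\<alpha> x) = \<beta> (f x))"

definition topological_lattice :: "'a topology \<Rightarrow> ('a, 'b) gorder_scheme \<Rightarrow> bool" where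
  "topological_lattice X L \<longleftrightarrow>
     Hausdorff_space X \<and> lattice L \<and> carrier L = topspace X \<and>
     continuous_map (prod_topology X X) X (\<lambda>(x, y). x \<sqinter>\<^bsub>L\<^esub> y) \<and>
     continuous_map (prod_topology X X) X (\<lambda>(x, y). x \<squnion>\<^bsub>L\<^esub> y)"

definition Z2_decreasing_lattice ::
    "'a topology \<Rightarrow> ('a \<Rightarrow> 'a) \<Rightarrow> ('a, 'b) gorder_scheme \<Rightarrow> bool" where
  "Z2_decreasing_lattice X \<alpha> L \<longleftrightarrow>
     topological_lattice X L \<and> involution_on_space X \<alpha> \<and>
     (\<forall>x \<in> topspace X. \<forall>y \<in> topspace X. x \<sqsubseteq>\<^bsub>L\<^esub> y \<longrightarrow> \<alpha> y \<sqsubseteq>\<^bsub>L\<^esub> \<alpha> x)"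

definition mean_on_space :: "'a topology \<Rightarrow> ('a \<Rightarrow> 'a \<Rightarrow> 'a) \<Rightarrow> bool" where
  "mean_on_space X p \<longleftrightarrow>
     continuous_map (prod_topology X X) X (\<lambda>(x, y). p x y) \<and>
     (\<forall>x \<in> topspace X. p x x = x) \<and>
     (\<forall>x \<in> topspace X. \<forall>y \<in> topspace X. p x y = p y x)"

definition equivariant_mean :: "'a topology \<Rightarrow> ('a \<Rightarrow> 'a) \<Rightarrow> ('a \<Rightarrow> 'a \<Rightarrow> 'a) \<Rightarrow> bool" where
  "equivariant_mean X \<alpha> p \<longleftrightarrow>
     mean_on_space X p \<and>
     (\<forall>x \<in> topspace X. \<forall>y \<in> topspace X. p (\<alpha> x) (\<alpha> y) = \<alpha> (p x y))"

text \<open>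
  HOL cannot quantify over types inside a definition, so the extensor and retract notions carry a
  type argument \<open>'z\<close> and test the metrizable spaces \<open>Z\<close> (of arbitrary carrier) whose points have
  type \<open>'z\<close>. The absolute notions are recovered by letting \<open>'z\<close> vary.

  ``\<open>Z\<close> contains \<open>Y\<close> as a closed subset'' is expressed by an embedding \<open>e\<close> with closed image, since
  \<open>Y\<close> and \<open>Z\<close> live over different types. In the equivariant case \<open>e\<close> is required to intertwine
  the involutions, which makes its image an invariant subset isomorphic to \<open>Y\<close>.
\<close>

definition absolute_extensor :: "'z itself \<Rightarrow> 'a topology \<Rightarrow> bool" where
  "absolute_extensor (_ :: 'z itself) Y \<longleftrightarrow>
     Hausdorff_space Y \<and>
     (\<forall>(Z :: 'z topology) A f.
        metrizable_space Z \<and> closedin Z A \<and> continuous_map (subtopology Z A) Y f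
        \<longrightarrow> (\<exists>F. continuous_map Z Y F \<and> (\<forall>x \<in> A. F x = f x)))"

definition absolute_retract :: "'z itself \<Rightarrow> 'a topology \<Rightarrow> bool" where
  "absolute_retract (_ :: 'z itself) Y \<longleftrightarrow>
     metrizable_space Y \<and>
     (\<forall>(Z :: 'z topology) e.
        metrizable_space Z \<and> embedding_map Y Z e \<and> closedin Z (e ` topspace Y)
        \<longrightarrow> (e ` topspace Y) retract_of_space Z)"

definition Z2_absolute_extensor :: "'z itself \<Rightarrow> 'a topology \<Rightarrow> ('a \<Rightarrow> 'a) \<Rightarrow> bool" where
  "Z2_absolute_extensor (_ :: 'z itself) Y \<beta> \<longleftrightarrow>
     Z2_space Y \<beta> \<and>
     (\<forall>(Z :: 'z topology) \<zeta> A f.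
        metrizable_space Z \<and> Z2_space Z \<zeta> \<and> closedin Z A \<and> \<zeta> ` A = A \<and>
        continuous_map (subtopology Z A) Y f \<and> equivariant_on A \<zeta> \<beta> f
        \<longrightarrow> (\<exists>F. continuous_map Z Y F \<and> equivariant_on (topspace Z) \<zeta> \<beta> F \<and>
                 (\<forall>x \<in> A. F x = f x)))"

definition Z2_absolute_retract :: "'z itself \<Rightarrow> 'a topology \<Rightarrow> ('a \<Rightarrow> 'a) \<Rightarrow> bool" where
  "Z2_absolute_retract (_ :: 'z itself) Y \<beta> \<longleftrightarrow>
     Z2_space Y \<beta> \<and> metrizable_space Y \<and>
     (\<forall>(Z :: 'z topology) \<zeta> e.
        metrizable_space Z \<and> Z2_space Z \<zeta> \<and>
        embedding_map Y Z e \<and> closedin Z (e ` topspace Y) \<and>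
        equivariant_on (topspace Y) \<beta> \<zeta> e
        \<longrightarrow> (\<exists>r. continuous_map Z (subtopology Z (e ` topspace Y)) r \<and>
                 equivariant_on (topspace Z) \<zeta> \<zeta> r \<and>
                 (\<forall>y \<in> e ` topspace Y. r y = y)))"

end

theory Submission
  imports Defs
begin

text \<open>
  Write \<open>p x y\<close> for \<open>(x \<sqinter> y) \<squnion> (\<theta> \<sqinter> (x \<squnion> y))\<close>. An order-reversing involution exchanges meets and
  joins, so, as \<open>\<alpha> \<theta> = \<theta>\<close>, it carries \<open>p x y\<close> to the dual expression
  \<open>(x' \<squnion> y') \<sqinter> (\<theta> \<squnion> (x' \<sqinter> y'))\<close> in \<open>x' = \<alpha> x\<close> and \<open>y' = \<alpha> y\<close>. The modular identity at \<open>\<theta>\<close>, for the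
  pair \<open>x' \<sqinter> y' \<sqsubseteq> x' \<squnion> y'\<close>, says exactly that this equals \<open>p x' y'\<close>; so \<open>p\<close> is equivariant
  (\<open>modular_median_equivariant_mean\<close>).

  An equivariant mean converts continuous extensions into equivariant ones by averaging over the
  two-element group. If \<open>F\<close> maps a space with involution \<open>\<zeta>\<close> continuously to \<open>X\<close>, then
  \<open>G z = p (F z) (\<alpha> (F (\<zeta> z)))\<close> is equivariant, since passing from \<open>z\<close> to \<open>\<zeta> z\<close> swaps the two
  arguments of \<open>p\<close> up to \<open>\<alpha>\<close>. Where \<open>F\<close> is already equivariant both arguments are \<open>F z\<close>, so \<open>G\<close>
  still extends what \<open>F\<close> extended (\<open>equivariant_averaging\<close>). The extensor case is immediate. In the
  retract case the averaged map is the retraction read in \<open>X\<close> through the inverse of the embedding,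
  where the mean is available.
\<close>

text \<open>
  An order-reversing involution is an isomorphism onto the dual order. Concretely, the nontrivial
  inequality for the meet holds because \<open>\<alpha> (\<alpha> x \<squnion> \<alpha> y)\<close> is a lower bound of \<open>x\<close> and \<open>y\<close>; the law for
  the join is the law for the meet at \<open>\<alpha> x, \<alpha> y\<close>.
\<close>
lemma (in lattice) antitone_involution_de_Morgan:
  assumes cl: "\<And>x. x \<in> carrier L \<Longrightarrow> \<alpha> x \<in> carrier L"
    and inv: "\<And>x. x \<in> carrier L \<Longrightarrow> \<alpha> (\<alpha> x) = x"
    and anti: "\<And>x y. x \<in> carrier L \<Longrightarrow> y \<in> carrier L \<Longrightarrow> x \<sqsubseteq> y \<Longrightarrow> \<alpha> y \<sqsubseteq> \<alpha> x"
    and x: "x \<in> carrier L" and y: "y \<in> carrier L"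
  shows "\<alpha> (x \<sqinter> y) = \<alpha> x \<squnion> \<alpha> y" and "\<alpha> (x \<squnion> y) = \<alpha> x \<sqinter> \<alpha> y"
proof -
  have meet: "\<alpha> (u \<sqinter> v) = \<alpha> u \<squnion> \<alpha> v" if u: "u \<in> carrier L" and v: "v \<in> carrier L" for u v
  proof (rule le_antisym)
    have "\<alpha> (\<alpha> u \<squnion> \<alpha> v) \<sqsubseteq> u" "\<alpha> (\<alpha> u \<squnion> \<alpha> v) \<sqsubseteq> v"
      using anti[of "\<alpha> u" "\<alpha> u \<squnion> \<alpha> v"] anti[of "\<alpha> v" "\<alpha> u \<squnion> \<alpha> v"] u v
      by (simp_all add: cl inv join_left join_right)
    then have "\<alpha> (\<alpha> u \<squnion> \<alpha> v) \<sqsubseteq> u \<sqinter> v"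
      using u v by (simp add: cl meet_le)
    then show "\<alpha> (u \<sqinter> v) \<sqsubseteq> \<alpha> u \<squnion> \<alpha> v"
      using anti[of "\<alpha> (\<alpha> u \<squnion> \<alpha> v)" "u \<sqinter> v"] u v by (simp add: cl inv)
    show "\<alpha> u \<squnion> \<alpha> v \<sqsubseteq> \<alpha> (u \<sqinter> v)"
      using anti u v by (simp add: cl join_le meet_left meet_right)
  qed (use u v cl in auto)
  show "\<alpha> (x \<sqinter> y) = \<alpha> x \<squnion> \<alpha> y"
    using meet x y .
  show "\<alpha> (x \<squnion> y) = \<alpha> x \<sqinter> \<alpha> y"
    using meet[of "\<alpha> x" "\<alpha> y"] x y by (metis cl inv meet_closed)
qed

text \<open>
  Idempotence is absorption. Equivariance is where the modular identity enters: it makes the median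
  self-dual, while \<open>\<alpha>\<close> carries the median to its dual because \<open>\<alpha> \<theta> = \<theta>\<close>.
\<close>
lemma modular_median_equivariant_mean:
  fixes X :: "'a topology" and L :: "('a, 'b) gorder_scheme"
  assumes "Z2_decreasing_lattice X \<alpha> L"
    and \<theta>: "\<theta> \<in> topspace X" and fixed: "\<alpha> \<theta> = \<theta>"
    and modular: "\<forall>a \<in> topspace X. \<forall>b \<in> topspace X.
           a \<sqsubseteq>\<^bsub>L\<^esub> b \<longrightarrow> a \<squnion>\<^bsub>L\<^esub> (\<theta> \<sqinter>\<^bsub>L\<^esub> b) = (a \<squnion>\<^bsub>L\<^esub> \<theta>) \<sqinter>\<^bsub>L\<^esub> b"
  shows "equivariant_mean X \<alpha> (\<lambda>x y. (x \<sqinter>\<^bsub>L\<^esub> y) \<squnion>\<^bsub>L\<^esub> (\<theta> \<sqinter>\<^bsub>L\<^esub> (x \<squnion>\<^bsub>L\<^esub> y)))"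
    (is "equivariant_mean X \<alpha> ?p")
proof -
  have tl: "topological_lattice X L" and \<alpha>: "involution_on_space X \<alpha>"
    and anti: "\<And>x y. x \<in> topspace X \<Longrightarrow> y \<in> topspace X \<Longrightarrow> x \<sqsubseteq>\<^bsub>L\<^esub> y \<Longrightarrow> \<alpha> y \<sqsubseteq>\<^bsub>L\<^esub> \<alpha> x"
    using assms(1) by (auto simp: Z2_decreasing_lattice_def)
  have carrier: "carrier L = topspace X"
    and meet: "continuous_map (prod_topology X X) X (\<lambda>(x, y). x \<sqinter>\<^bsub>L\<^esub> y)"
    and join: "continuous_map (prod_topology X X) X (\<lambda>(x, y). x \<squnion>\<^bsub>L\<^esub> y)"
    using tl by (auto simp: topological_lattice_def)
  interpret lattice L
    using tl by (simp add: topological_lattice_def)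
  have cl: "\<alpha> x \<in> topspace X" and inv: "\<alpha> (\<alpha> x) = x" if "x \<in> topspace X" for x
    using \<alpha> that by (auto simp: involution_on_space_def continuous_map_def)
  have meetI: "continuous_map (prod_topology X X) X (\<lambda>q. f q \<sqinter>\<^bsub>L\<^esub> g q)"
    and joinI: "continuous_map (prod_topology X X) X (\<lambda>q. f q \<squnion>\<^bsub>L\<^esub> g q)"
    if "continuous_map (prod_topology X X) X f" "continuous_map (prod_topology X X) X g" for f g
    using continuous_map_compose[OF continuous_map_pairedI[OF that] meet]
      continuous_map_compose[OF continuous_map_pairedI[OF that] join]
    by (simp_all add: o_def)
  have "continuous_map (prod_topology X X) X
          (\<lambda>q. (fst q \<sqinter>\<^bsub>L\<^esub> snd q) \<squnion>\<^bsub>L\<^esub> (\<theta> \<sqinter>\<^bsub>L\<^esub> (fst q \<squnion>\<^bsub>L\<^esub> snd q)))"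
    using \<theta> by (intro meetI joinI) (auto simp: continuous_map_fst continuous_map_snd)
  then have cont: "continuous_map (prod_topology X X) X (\<lambda>(x, y). ?p x y)"
    by (simp add: case_prod_unfold)
  have idem: "?p x x = x" if "x \<in> topspace X" for x
  proof -
    have "x \<in> carrier L" "\<theta> \<in> carrier L"
      using that \<theta> carrier by auto
    then have "x \<sqinter>\<^bsub>L\<^esub> x = x" "x \<squnion>\<^bsub>L\<^esub> x = x" "x \<squnion>\<^bsub>L\<^esub> (\<theta> \<sqinter>\<^bsub>L\<^esub> x) = x"
      by (simp_all add: le_antisym meet_le join_le meet_left meet_right join_left)
    then show ?thesis
      by simp
  qed
  have sym: "?p x y = ?p y x" for x y
    by (simp add: meet_comm[of L x y] join_comm[of L x y])
  have equiv: "?p (\<alpha> x) (\<alpha> y) = \<alpha> (?p x y)" if x: "x \<in> topspace X" and y: "y \<in> topspace X" for x y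
  proof -
    note in_carrier = x[folded carrier] y[folded carrier] \<theta>[folded carrier] cl[folded carrier]
    note de_Morgan = antitone_involution_de_Morgan[of \<alpha>, unfolded carrier, OF cl inv anti,
        folded carrier]
    let ?a = "\<alpha> x \<sqinter>\<^bsub>L\<^esub> \<alpha> y" and ?b = "\<alpha> x \<squnion>\<^bsub>L\<^esub> \<alpha> y"
    have "?a \<sqsubseteq>\<^bsub>L\<^esub> \<alpha> x" "\<alpha> x \<sqsubseteq>\<^bsub>L\<^esub> ?b"
      using in_carrier by (auto intro: meet_left join_left)
    then have "?a \<sqsubseteq>\<^bsub>L\<^esub> ?b"
      using in_carrier by (meson le_trans meet_closed join_closed)
    then have "?p (\<alpha> x) (\<alpha> y) = (?a \<squnion>\<^bsub>L\<^esub> \<theta>) \<sqinter>\<^bsub>L\<^esub> ?b"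
      using modular in_carrier by (simp add: carrier[symmetric])
    also have "\<dots> = \<alpha> (?p x y)"
      using in_carrier
      by (simp add: de_Morgan fixed join_comm[of L _ \<theta>] meet_comm[of L _ "\<alpha> x \<squnion>\<^bsub>L\<^esub> \<alpha> y"])
    finally show ?thesis .
  qed
  show ?thesis
    unfolding equivariant_mean_def mean_on_space_def
    using cont idem sym equiv by blast
qed

text \<open>
  Averaging over the group of order two: the two arguments of the mean are \<open>F\<close> and its conjugate
  under the group action, which coincide wherever \<open>F\<close> is equivariant.
\<close>
lemma equivariant_averaging:
  assumes p: "equivariant_mean X \<alpha> p"
    and \<alpha>: "involution_on_space X \<alpha>" and \<zeta>: "involution_on_space Z \<zeta>"
    and F: "continuous_map Z X F"
    and A: "A \<subseteq> topspace Z" and FA: "equivariant_on A \<zeta> \<alpha> F"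
  obtains G where "continuous_map Z X G" "equivariant_on (topspace Z) \<zeta> \<alpha> G" "\<forall>x \<in> A. G x = F x"
proof
  let ?G = "\<lambda>z. p (F z) (\<alpha> (F (\<zeta> z)))"
  have cont_p: "continuous_map (prod_topology X X) X (\<lambda>(x, y). p x y)"
    and idem: "\<And>x. x \<in> topspace X \<Longrightarrow> p x x = x"
    and sym: "\<And>x y. x \<in> topspace X \<Longrightarrow> y \<in> topspace X \<Longrightarrow> p x y = p y x"
    and equiv: "\<And>x y. x \<in> topspace X \<Longrightarrow> y \<in> topspace X \<Longrightarrow> p (\<alpha> x) (\<alpha> y) = \<alpha> (p x y)"
    using p by (auto simp: equivariant_mean_def mean_on_space_def)
  have cont_\<alpha>: "continuous_map X X \<alpha>" and cont_\<zeta>: "continuous_map Z Z \<zeta>"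
    and inv_\<alpha>: "\<And>x. x \<in> topspace X \<Longrightarrow> \<alpha> (\<alpha> x) = x"
    and inv_\<zeta>: "\<And>z. z \<in> topspace Z \<Longrightarrow> \<zeta> (\<zeta> z) = z"
    using \<alpha> \<zeta> by (auto simp: involution_on_space_def)
  have in_X: "\<And>z. z \<in> topspace Z \<Longrightarrow> F z \<in> topspace X"
    "\<And>x. x \<in> topspace X \<Longrightarrow> \<alpha> x \<in> topspace X" "\<And>z. z \<in> topspace Z \<Longrightarrow> \<zeta> z \<in> topspace Z"
    using F cont_\<alpha> cont_\<zeta> by (auto simp: continuous_map_def)
  have conj: "continuous_map Z X (\<lambda>z. \<alpha> (F (\<zeta> z)))"
    using continuous_map_compose[OF continuous_map_compose[OF cont_\<zeta> F] cont_\<alpha>]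
    by (simp add: o_def)
  show "continuous_map Z X ?G"
    using continuous_map_compose[OF continuous_map_pairedI[OF F conj] cont_p]
    by (simp add: o_def)
  show "equivariant_on (topspace Z) \<zeta> \<alpha> ?G"
    unfolding equivariant_on_def
  proof
    fix z assume z: "z \<in> topspace Z"
    have "?G (\<zeta> z) = p (\<alpha> (F z)) (F (\<zeta> z))"
      using z by (simp add: inv_\<zeta> in_X sym)
    also have "\<dots> = p (\<alpha> (F z)) (\<alpha> (\<alpha> (F (\<zeta> z))))"
      using z by (simp add: inv_\<alpha> in_X)
    also have "\<dots> = \<alpha> (?G z)"
      using z by (simp add: equiv in_X)
    finally show "?G (\<zeta> z) = \<alpha> (?G z)" .
  qed
  show "\<forall>x \<in> A. ?G x = F x"
  proof
    fix x assume x: "x \<in> A"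
    then have "\<alpha> (F (\<zeta> x)) = F x"
      using FA A by (auto simp: equivariant_on_def inv_\<alpha> in_X)
    then show "?G x = F x"
      using x A by (auto simp: idem in_X)
  qed
qed

lemma Z2_absolute_extensor_if_equivariant_mean:
  assumes p: "equivariant_mean X \<alpha> p" and \<alpha>: "involution_on_space X \<alpha>"
    and AE: "absolute_extensor TYPE('z) X"
  shows "Z2_absolute_extensor TYPE('z) X \<alpha>"
  unfolding Z2_absolute_extensor_def
proof (intro conjI allI impI; (elim conjE)?)
  show "Z2_space X \<alpha>"
    using AE \<alpha> by (simp add: absolute_extensor_def Z2_space_def)
next
  fix Z :: "'z topology" and \<zeta> A f
  assume Z: "metrizable_space Z" "Z2_space Z \<zeta>" and A: "closedin Z A" "\<zeta> ` A = A"
    and f: "continuous_map (subtopology Z A) X f" "equivariant_on A \<zeta> \<alpha> f"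
  obtain F where F: "continuous_map Z X F" "\<forall>x \<in> A. F x = f x"
    using AE Z(1) A(1) f(1) unfolding absolute_extensor_def by blast
  have "equivariant_on A \<zeta> \<alpha> F"
    unfolding equivariant_on_def
  proof
    fix x assume x: "x \<in> A"
    then have "\<zeta> x \<in> A"
      using A(2) by blast
    then show "F (\<zeta> x) = \<alpha> (F x)"
      using x F(2) f(2) by (simp add: equivariant_on_def)
  qed
  then obtain G where "continuous_map Z X G" "equivariant_on (topspace Z) \<zeta> \<alpha> G" "\<forall>x \<in> A. G x = F x"
    using equivariant_averaging[OF p \<alpha> _ F(1) closedin_subset[OF A(1)]] Z(2)
    unfolding Z2_space_def by blast
  with F(2) show "\<exists>F. continuous_map Z X F \<and> equivariant_on (topspace Z) \<zeta> \<alpha> F \<and> (\<forall>x \<in> A. F x = f x)"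
    by auto
qed

lemma Z2_absolute_retract_if_equivariant_mean:
  fixes X :: "'a topology"
  assumes p: "equivariant_mean X \<alpha> p" and \<alpha>: "involution_on_space X \<alpha>"
    and AR: "absolute_retract TYPE('z) X"
  shows "Z2_absolute_retract TYPE('z) X \<alpha>"
  unfolding Z2_absolute_retract_def
proof (intro conjI allI impI; (elim conjE)?)
  show X: "metrizable_space X"
    using AR by (simp add: absolute_retract_def)
  then show "Z2_space X \<alpha>"
    using \<alpha> by (simp add: Z2_space_def metrizable_imp_Hausdorff_space)
next
  fix Z :: "'z topology" and \<zeta> and e :: "'a \<Rightarrow> 'z"
  let ?A = "e ` topspace X"
  assume Z: "metrizable_space Z" "Z2_space Z \<zeta>" and e: "embedding_map X Z e"
    and A: "closedin Z ?A" and e_equiv: "equivariant_on (topspace X) \<alpha> \<zeta> e"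
  obtain r where r: "continuous_map Z (subtopology Z ?A) r" "\<forall>y \<in> ?A. r y = y"
    using AR Z(1) e A unfolding absolute_retract_def retract_of_space_def by blast
  obtain g where "homeomorphic_maps X (subtopology Z ?A) e g"
    using e by (auto simp: embedding_map_def homeomorphic_map_maps)
  then have cont_e: "continuous_map X (subtopology Z ?A) e"
    and g: "continuous_map (subtopology Z ?A) X g" "\<And>x. x \<in> topspace X \<Longrightarrow> g (e x) = x"
    by (auto simp: homeomorphic_maps_def)
  \<comment> \<open>The mean lives on \<open>X\<close>, so it is \<open>g \<circ> r\<close> rather than \<open>r\<close> that can be averaged.\<close>
  have F: "continuous_map Z X (g \<circ> r)"
    using r(1) g(1) by (rule continuous_map_compose)
  have F_e: "(g \<circ> r) (e x) = x" if "x \<in> topspace X" for x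
    using that r(2) g(2) by simp
  have "equivariant_on ?A \<zeta> \<alpha> (g \<circ> r)"
    unfolding equivariant_on_def
  proof clarify
    fix x assume x: "x \<in> topspace X"
    then have "\<alpha> x \<in> topspace X"
      using \<alpha> by (auto simp: involution_on_space_def continuous_map_def)
    moreover have "\<zeta> (e x) = e (\<alpha> x)"
      using x e_equiv by (simp add: equivariant_on_def)
    ultimately show "(g \<circ> r) (\<zeta> (e x)) = \<alpha> ((g \<circ> r) (e x))"
      using x by (metis F_e)
  qed
  then obtain G where G: "continuous_map Z X G" "equivariant_on (topspace Z) \<zeta> \<alpha> G"
    "\<forall>y \<in> ?A. G y = (g \<circ> r) y"
    using equivariant_averaging[OF p \<alpha> _ F closedin_subset[OF A]] Z(2)
    unfolding Z2_space_def by blast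
  have "continuous_map Z (subtopology Z ?A) (e \<circ> G)"
    using G(1) cont_e by (rule continuous_map_compose)
  moreover have "equivariant_on (topspace Z) \<zeta> \<zeta> (e \<circ> G)"
    using G(1,2) e_equiv by (auto simp: equivariant_on_def continuous_map_def Pi_iff)
  moreover have "\<forall>y \<in> ?A. (e \<circ> G) y = y"
    using G(3) F_e by auto
  ultimately show "\<exists>r. continuous_map Z (subtopology Z ?A) r \<and> equivariant_on (topspace Z) \<zeta> \<zeta> r \<and>
      (\<forall>y \<in> ?A. r y = y)"
    by blast
qed

theorem theorem4p5:
  fixes X :: "'a topology" and \<alpha> :: "'a \<Rightarrow> 'a" and L :: "('a, 'b) gorder_scheme" and \<theta> :: 'a
  assumes "Z2_decreasing_lattice X \<alpha> L"
    and "\<theta> \<in> topspace X" and "\<alpha> \<theta> = \<theta>"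
    and "\<forall>a \<in> topspace X. \<forall>b \<in> topspace X.
           a \<sqsubseteq>\<^bsub>L\<^esub> b \<longrightarrow> a \<squnion>\<^bsub>L\<^esub> (\<theta> \<sqinter>\<^bsub>L\<^esub> b) = (a \<squnion>\<^bsub>L\<^esub> \<theta>) \<sqinter>\<^bsub>L\<^esub> b"
  shows "equivariant_mean X \<alpha> (\<lambda>x y. (x \<sqinter>\<^bsub>L\<^esub> y) \<squnion>\<^bsub>L\<^esub> (\<theta> \<sqinter>\<^bsub>L\<^esub> (x \<squnion>\<^bsub>L\<^esub> y)))
    \<and> (absolute_retract TYPE('z) X \<longrightarrow> Z2_absolute_retract TYPE('z) X \<alpha>)
    \<and> (absolute_extensor TYPE('z) X \<longrightarrow> Z2_absolute_extensor TYPE('z) X \<alpha>)"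
proof -
  note mean = modular_median_equivariant_mean[OF assms]
  have \<alpha>: "involution_on_space X \<alpha>"
    using assms(1) by (simp add: Z2_decreasing_lattice_def)
  show ?thesis
    using mean Z2_absolute_retract_if_equivariant_mean[OF mean \<alpha>]
      Z2_absolute_extensor_if_equivariant_mean[OF mean \<alpha>]
    by blast
qed

end
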